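(* Let $S$ be a semigroup, let $e\in S$ be an idempotent, and let $T\subset S$. Then $T$ is a rectangular band subsemigroup of $S$ containing $e$ if and only if $T=T_LT_R$ for some sets $T_L$ and $T_R$ such that $e\in T_L\subset\mathbf{LZ}(e)$, $e\in T_R\subset\mathbf{RZ}(e)$, and $T_RT_L=\{e\}$. In this case, $T_L$ and $T_R$ are unique.
   Context: A rectangular band is a semigroup in which $aba=a$ for all $a,b$. For $e\in S$, $\mathbf{RZ}(e)=\{b\in S\mid be=e\text{ and }eb=b\}$ and $\mathbf{LZ}(e)=\{b\in S\mid eb=e\text{ and }be=b\}$. For subsets $A,B\subset S$, $AB=\{ab\mid a\in A,\,b\in B\}$. The symbol $\subset$ allows equality. *)

theory Defs
  imports "HOL-Library.Set_Algebras"
begin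

text \<open>
  The ambient semigroup is a type of class \<^class>\<open>semigroup_mult\<close>; the product of two
  subsets is the one of \<^theory>\<open>HOL-Library.Set_Algebras\<close>.
\<close>

definition subsemigroup :: "'a::semigroup_mult set \<Rightarrow> bool"
  where "subsemigroup T \<longleftrightarrow> T \<noteq> {} \<and> (\<forall>a\<in>T. \<forall>b\<in>T. a * b \<in> T)"

definition rectangular_band :: "'a::semigroup_mult set \<Rightarrow> bool"
  where "rectangular_band T \<longleftrightarrow> subsemigroup T \<and> (\<forall>a\<in>T. \<forall>b\<in>T. a * b * a = a)"

definition RZ :: "'a::semigroup_mult \<Rightarrow> 'a set"
  where "RZ e = {b. b * e = e \<and> e * b = b}"

definition LZ :: "'a::semigroup_mult \<Rightarrow> 'a set"
  where "LZ e = {b. e * b = e \<and> b * e = b}"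

definition LZ_RZ_factorization ::
    "'a::semigroup_mult \<Rightarrow> 'a set \<Rightarrow> 'a set \<Rightarrow> 'a set \<Rightarrow> bool"
  where "LZ_RZ_factorization e T T\<^sub>L T\<^sub>R \<longleftrightarrow>
    T = T\<^sub>L * T\<^sub>R \<and>
    e \<in> T\<^sub>L \<and> T\<^sub>L \<subseteq> LZ e \<and>
    e \<in> T\<^sub>R \<and> T\<^sub>R \<subseteq> RZ e \<and>
    T\<^sub>R * T\<^sub>L = {e}"

end

theory Submission
  imports Defs
begin

text \<open>
  The factors of \<open>T\<close> can be read off as the principal one-sided ideals \<open>T\<^sub>L = T e\<close> and \<open>T\<^sub>R = e T\<close>,
  which gives uniqueness. For existence, \<open>t e t = t\<close> writes \<open>t\<close> as \<open>(t e)(e t)\<close>.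
  Conversely, \<open>T\<^sub>R T\<^sub>L = {e}\<close> makes the product on \<open>T\<^sub>L T\<^sub>R\<close> satisfy \<open>(a b)(c d) = a d\<close>.
\<close>

text \<open>The law \<open>a * b * a = a\<close> with \<open>b = a\<close> gives a^3 = a, and with
  \<open>b = a * a\<close> it gives a^4 = a; hence a^2 = a^3 a = a^4 = a.\<close>

lemma rectangular_band_idem:
  assumes "rectangular_band T" and "a \<in> T"
  shows "a * a = a"
proof -
  have cube: "a * a * a = a" and "a * (a * a) * a = a"
    using assms unfolding rectangular_band_def subsemigroup_def by blast+
  then show ?thesis
    by (metis mult.assoc)
qed

lemma rectangular_band_factorization:
  assumes band: "rectangular_band T" and e: "e \<in> T"
  shows "LZ_RZ_factorization e T ((\<lambda>t. t * e) ` T) ((\<lambda>t. e * t) ` T)"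
proof -
  have closed: "a * b \<in> T" and aba: "a * (b * a) = a" if "a \<in> T" "b \<in> T" for a b
    using band that unfolding rectangular_band_def subsemigroup_def by (auto simp: mult.assoc)
  have ee: "e * e = e"
    using rectangular_band_idem[OF band e] .
  have eex: "e * (e * x) = e * x" for x
    by (metis ee mult.assoc)
  \<comment> \<open>The band law for \<open>e\<close> and the product \<open>t * s\<close>; it
    collapses (et)(se) to \<open>e\<close>.\<close>
  have ete: "e * (t * (s * e)) = e" if "t \<in> T" "s \<in> T" for t s
    using aba[OF e closed[OF that]] by (simp add: mult.assoc)
  have "T = (\<lambda>t. t * e) ` T * (\<lambda>t. e * t) ` T"
  proof
    show "T \<subseteq> (\<lambda>t. t * e) ` T * (\<lambda>t. e * t) ` T"
    proof
      fix t assume t: "t \<in> T"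
      then have "t = (t * e) * (e * t)"
        using aba[OF t e] by (simp add: mult.assoc eex)
      then show "t \<in> (\<lambda>t. t * e) ` T * (\<lambda>t. e * t) ` T"
        using t by (metis imageI set_times_intro)
    qed
    show "(\<lambda>t. t * e) ` T * (\<lambda>t. e * t) ` T \<subseteq> T"
      using e by (auto elim!: set_times_elim intro!: closed)
  qed
  moreover have "(\<lambda>t. e * t) ` T * (\<lambda>t. t * e) ` T = {e}"
  proof
    show "(\<lambda>t. e * t) ` T * (\<lambda>t. t * e) ` T \<subseteq> {e}"
      by (auto elim!: set_times_elim simp: mult.assoc ete)
    have "(e * e) * (e * e) \<in> (\<lambda>t. e * t) ` T * (\<lambda>t. t * e) ` T"
      using e by (intro set_times_intro imageI)
    then show "{e} \<subseteq> (\<lambda>t. e * t) ` T * (\<lambda>t. t * e) ` T"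
      by (simp add: ee)
  qed
  \<comment> \<open>\<open>e\<close> lies in both factors as \<open>e * e\<close>; the law e t e = e
    puts \<open>t * e\<close> in \<open>LZ e\<close> and \<open>e * t\<close> in
    \<open>RZ e\<close>.\<close>
  ultimately show ?thesis
    using e unfolding LZ_RZ_factorization_def LZ_def RZ_def
    by (auto simp: mult.assoc ee eex aba intro!: image_eqI[of e _ e])
qed

lemma factorization_rectangular_band:
  assumes "LZ_RZ_factorization e T L R"
  shows "rectangular_band T" and "e \<in> T"
proof -
  have T: "T = L * R" and eL: "e \<in> L" and eR: "e \<in> R"
    and L: "\<And>a. a \<in> L \<Longrightarrow> a * e = a \<and> e * a = e"
    and R: "\<And>b. b \<in> R \<Longrightarrow> e * b = b \<and> b * e = e"
    and RL: "\<And>a b. a \<in> L \<Longrightarrow> b \<in> R \<Longrightarrow> b * a = e"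
    using assms unfolding LZ_RZ_factorization_def LZ_def RZ_def by auto
  \<comment> \<open>The middle \<open>b * c\<close> lies in \<open>R * L\<close>, so it is
    \<open>e\<close>, which \<open>a\<close> absorbs.\<close>
  have mult: "(a * b) * (c * d) = a * d" if "a \<in> L" "b \<in> R" "c \<in> L" "d \<in> R" for a b c d
    using that by (metis L RL mult.assoc)
  show "e \<in> T"
    using T eL eR L by (metis set_times_intro)
  then show "rectangular_band T"
    unfolding rectangular_band_def subsemigroup_def T
    by (auto elim!: set_times_elim simp: mult intro: set_times_intro)
qed

text \<open>Since b e = e and a e = a, right multiplication by \<open>e\<close> sends
  \<open>a * b\<close> to \<open>a\<close>; it reaches every \<open>a\<close> in \<open>L\<close>
  because \<open>R\<close> contains \<open>e\<close>. Left multiplication by \<open>e\<close>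
  recovers \<open>b\<close> in the same way.\<close>

lemma factorization_factors:
  assumes "LZ_RZ_factorization e T L R"
  shows "L = (\<lambda>t. t * e) ` T" and "R = (\<lambda>t. e * t) ` T"
proof -
  have T: "T = L * R" and eL: "e \<in> L" and eR: "e \<in> R"
    and L: "\<And>a. a \<in> L \<Longrightarrow> a * e = a \<and> e * a = e"
    and R: "\<And>b. b \<in> R \<Longrightarrow> e * b = b \<and> b * e = e"
    using assms unfolding LZ_RZ_factorization_def LZ_def RZ_def by auto
  have right: "(a * b) * e = a" and left: "e * (a * b) = b" if "a \<in> L" "b \<in> R" for a b
    using that by (metis L R mult.assoc)+
  show "L = (\<lambda>t. t * e) ` T"
    unfolding T using right eR by (force elim!: set_times_elim intro: set_times_intro)
  show "R = (\<lambda>t. e * t) ` T"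
    unfolding T using left eL by (force elim!: set_times_elim intro: set_times_intro)
qed

theorem proposition6p4:
  fixes e :: "'a::semigroup_mult" and T :: "'a set"
  assumes "e * e = e"
  shows "(rectangular_band T \<and> e \<in> T \<longleftrightarrow> (\<exists>T\<^sub>L T\<^sub>R. LZ_RZ_factorization e T T\<^sub>L T\<^sub>R)) \<and>
    (rectangular_band T \<and> e \<in> T \<longrightarrow>
      (\<forall>T\<^sub>L T\<^sub>R T\<^sub>L' T\<^sub>R'.
        LZ_RZ_factorization e T T\<^sub>L T\<^sub>R \<and> LZ_RZ_factorization e T T\<^sub>L' T\<^sub>R' \<longrightarrow>
        T\<^sub>L = T\<^sub>L' \<and> T\<^sub>R = T\<^sub>R'))"
  using rectangular_band_factorization factorization_rectangular_band factorization_factors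
  by metis

end
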